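(* Let $\rho$ be a given line, let $r$ be a line rational with respect to $\rho$, and let $\gamma=\zeta-\eta$ be an apotome with respect to $\rho$ with terms $\zeta>\eta$. Let $\delta$ be the line with $\gamma\delta=r^2$. Then there are lines $\psi,\omega$ such that $\delta=\psi+\omega$ is a binomial line with respect to $\rho$ with terms $\psi>\omega$, $\psi$ is commensurable with $\zeta$, $\omega$ is commensurable with $\eta$, $\psi/\omega=\zeta/\eta$, and the binomial $\delta=\psi+\omega$ has the same order (first, second, third, fourth, fifth or sixth) with respect to $\rho$ as the apotome $\gamma=\zeta-\eta$.
   Context: Lines (straight-line segments) are represented by positive real numbers, and the rectangle contained by lines $a,b$ by the product $ab$. Two lines (or two areas) are commensurable if their quotient is a rational number, and incommensurable otherwise. A line $a$ is rational with respect to a given line $\rho$ if $a^2$ and $\rho^2$ are commensurable. A line $\gamma$ is an apotome with respect to $\rho$, with terms $\zeta,\eta$, if $\gamma=\zeta-\eta$ where $\zeta>\eta$ are lines such that $\zeta,\eta$ are incommensurable and $\zeta^2,\eta^2,\rho^2$ are commensurable. A line $\delta$ is a binomial with respect to $\rho$, with terms $\zeta,\eta$, if $\delta=\zeta+\eta$ where $\zeta>\eta$ are lines such that $\zeta,\eta$ are incommensurable and $\zeta^2,\eta^2,\rho^2$ are commensurable. Order of an apotome $\zeta-\eta$ or binomial $\zeta+\eta$ ($\zeta>\eta$) with respect to $\rho$: let $\theta>0$ be defined by $\theta^2=\zeta^2-\eta^2$. If $\theta$ is commensurable with $\zeta$, the order is first if $\zeta$ is commensurable with $\rho$, second if $\eta$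 is commensurable with $\rho$, third if neither $\zeta$ nor $\eta$ is commensurable with $\rho$. If $\theta$ is incommensurable with $\zeta$, the order is fourth if $\zeta$ is commensurable with $\rho$, fifth if $\eta$ is commensurable with $\rho$, sixth if neither is. *)

theory Defs
  imports Complex_Main
begin

text \<open>
  A line is a positive real, and a square on or rectangle contained by lines is a product of
  reals. Commensurability is used both for lines and for areas.
\<close>

definition commensurable :: "real \<Rightarrow> real \<Rightarrow> bool" where
  "commensurable a b \<longleftrightarrow> a / b \<in> \<rat>"

definition rational_line :: "real \<Rightarrow> real \<Rightarrow> bool" where
  "rational_line \<rho> a \<longleftrightarrow> commensurable (a\<^sup>2) (\<rho>\<^sup>2)"

text \<open>The conditions on the terms that apotomes and binomials share.\<close>

definition admissible_terms :: "real \<Rightarrow> real \<Rightarrow> real \<Rightarrow> bool" where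
  "admissible_terms \<rho> \<zeta> \<eta> \<longleftrightarrow>
     0 < \<eta> \<and> \<eta> < \<zeta> \<and> \<not> commensurable \<zeta> \<eta> \<and>
     commensurable (\<zeta>\<^sup>2) (\<eta>\<^sup>2) \<and> commensurable (\<zeta>\<^sup>2) (\<rho>\<^sup>2) \<and> commensurable (\<eta>\<^sup>2) (\<rho>\<^sup>2)"

definition is_apotome :: "real \<Rightarrow> real \<Rightarrow> real \<Rightarrow> real \<Rightarrow> bool" where
  "is_apotome \<rho> \<gamma> \<zeta> \<eta> \<longleftrightarrow> \<gamma> = \<zeta> - \<eta> \<and> admissible_terms \<rho> \<zeta> \<eta>"

definition is_binomial :: "real \<Rightarrow> real \<Rightarrow> real \<Rightarrow> real \<Rightarrow> bool" where
  "is_binomial \<rho> \<delta> \<zeta> \<eta> \<longleftrightarrow> \<delta> = \<zeta> + \<eta> \<and> admissible_terms \<rho> \<zeta> \<eta>"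

datatype line_order = First | Second | Third | Fourth | Fifth | Sixth

text \<open>
  The order of the apotome \<open>\<zeta> - \<eta>\<close> or of the binomial \<open>\<zeta> + \<eta>\<close> is determined by the terms alone.
\<close>

definition has_order :: "real \<Rightarrow> real \<Rightarrow> real \<Rightarrow> line_order \<Rightarrow> bool" where
  "has_order \<rho> \<zeta> \<eta> k \<longleftrightarrow>
     (let \<theta> = sqrt (\<zeta>\<^sup>2 - \<eta>\<^sup>2) in
      case k of
        First \<Rightarrow> commensurable \<theta> \<zeta> \<and> commensurable \<zeta> \<rho>
      | Second \<Rightarrow> commensurable \<theta> \<zeta> \<and> commensurable \<eta> \<rho>
      | Third \<Rightarrow> commensurable \<theta> \<zeta> \<and> \<not> commensurable \<zeta> \<rho> \<and> \<not> commensurable \<eta> \<rho>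
      | Fourth \<Rightarrow> \<not> commensurable \<theta> \<zeta> \<and> commensurable \<zeta> \<rho>
      | Fifth \<Rightarrow> \<not> commensurable \<theta> \<zeta> \<and> commensurable \<eta> \<rho>
      | Sixth \<Rightarrow> \<not> commensurable \<theta> \<zeta> \<and> \<not> commensurable \<zeta> \<rho> \<and> \<not> commensurable \<eta> \<rho>)"

lemma has_order_unique:
  assumes "0 < \<rho>" and "admissible_terms \<rho> \<zeta> \<eta>"
  shows "\<exists>!k. has_order \<rho> \<zeta> \<eta> k"
proof -
  have excl: "\<not> (commensurable \<zeta> \<rho> \<and> commensurable \<eta> \<rho>)"
  proof
    assume "commensurable \<zeta> \<rho> \<and> commensurable \<eta> \<rho>"
    then have "(\<zeta> / \<rho>) / (\<eta> / \<rho>) \<in> \<rat>"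
      unfolding commensurable_def by (blast intro: Rats_divide)
    with assms show False
      by (simp add: admissible_terms_def commensurable_def)
  qed
  let ?C = "commensurable (sqrt (\<zeta>\<^sup>2 - \<eta>\<^sup>2)) \<zeta>"
  let ?k = "if ?C then (if commensurable \<zeta> \<rho> then First
                        else if commensurable \<eta> \<rho> then Second else Third)
            else (if commensurable \<zeta> \<rho> then Fourth
                  else if commensurable \<eta> \<rho> then Fifth else Sixth)"
  show ?thesis
  proof (rule ex1I[of _ ?k])
    show "has_order \<rho> \<zeta> \<eta> ?k"
      by (simp add: has_order_def)
    show "k = ?k" if "has_order \<rho> \<zeta> \<eta> k" for k
      using that excl by (cases k) (auto simp: has_order_def)
  qed
qed

end

theory Submission
  imports Defs
begin

text \<open>
  Rationalising the denominator gives \<open>\<delta> = r\<^sup>2 / (\<zeta> - \<eta>) = c * (\<zeta> + \<eta>)\<close> with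
  \<open>c = r\<^sup>2 / (\<zeta>\<^sup>2 - \<eta>\<^sup>2)\<close>. The squares of \<open>r\<close>, \<open>\<zeta>\<close> and \<open>\<eta>\<close> are all rational multiples of
  \<open>\<rho>\<^sup>2\<close>, so \<open>c\<close> is a positive rational number. Hence \<open>\<psi> = c * \<zeta>\<close> and \<open>\<omega> = c * \<eta>\<close> serve:
  being admissible terms and having a given order are unchanged when both terms are multiplied
  by the same positive rational (\<open>admissible_terms_scale\<close>, \<open>has_order_scale\<close>), because such a
  factor does not affect commensurability and also multiplies \<open>sqrt (\<zeta>\<^sup>2 - \<eta>\<^sup>2)\<close>.
\<close>

lemma Rats_mult_cancel_left:
  fixes c x :: real
  assumes "c \<in> \<rat>" and "c \<noteq> 0"
  shows "c * x \<in> \<rat> \<longleftrightarrow> x \<in> \<rat>"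
proof
  assume "c * x \<in> \<rat>"
  then have "c * x / c \<in> \<rat>"
    using assms(1) by (rule Rats_divide)
  with assms(2) show "x \<in> \<rat>"
    by simp
qed (use assms(1) in simp)

lemma commensurable_scale_left:
  assumes "c \<in> \<rat>" and "c \<noteq> 0"
  shows "commensurable (c * a) b \<longleftrightarrow> commensurable a b"
  using Rats_mult_cancel_left[OF assms, of "a / b"] by (simp add: commensurable_def)

lemma commensurable_commute: "commensurable a b \<longleftrightarrow> commensurable b a"
  using Rats_inverse[of "a / b"] Rats_inverse[of "b / a"] by (auto simp: commensurable_def)

lemma commensurable_scale_right:
  assumes "c \<in> \<rat>" and "c \<noteq> 0"
  shows "commensurable a (c * b) \<longleftrightarrow> commensurable a b"
  using commensurable_scale_left[OF assms] commensurable_commute by blast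

lemma admissible_terms_scale:
  assumes "c \<in> \<rat>" and "0 < c"
  shows "admissible_terms \<rho> (c * \<zeta>) (c * \<eta>) \<longleftrightarrow> admissible_terms \<rho> \<zeta> \<eta>"
proof -
  have "c\<^sup>2 \<in> \<rat>" and "c\<^sup>2 \<noteq> 0"
    using assms by simp_all
  then show ?thesis
    using assms
    by (simp add: admissible_terms_def power_mult_distrib commensurable_scale_left
        commensurable_scale_right zero_less_mult_iff)
qed

lemma has_order_scale:
  assumes "c \<in> \<rat>" and "0 < c"
  shows "has_order \<rho> (c * \<zeta>) (c * \<eta>) k \<longleftrightarrow> has_order \<rho> \<zeta> \<eta> k"
proof -
  have "(c * \<zeta>)\<^sup>2 - (c * \<eta>)\<^sup>2 = c\<^sup>2 * (\<zeta>\<^sup>2 - \<eta>\<^sup>2)"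
    by (simp add: power_mult_distrib right_diff_distrib)
  then have "sqrt ((c * \<zeta>)\<^sup>2 - (c * \<eta>)\<^sup>2) = c * sqrt (\<zeta>\<^sup>2 - \<eta>\<^sup>2)"
    using assms(2) by (simp add: real_sqrt_mult)
  then show ?thesis
    using assms
    by (cases k)
      (simp_all add: has_order_def commensurable_scale_left commensurable_scale_right)
qed

theorem propositionX113:
  fixes \<rho> r \<gamma> \<delta> \<zeta> \<eta> :: real
  assumes "0 < \<rho>"
    and "0 < r" and "rational_line \<rho> r"
    and "is_apotome \<rho> \<gamma> \<zeta> \<eta>"
    and "0 < \<delta>" and "\<gamma> * \<delta> = r\<^sup>2"
  shows "\<exists>\<psi> \<omega>. is_binomial \<rho> \<delta> \<psi> \<omega> \<and>
           commensurable \<psi> \<zeta> \<and> commensurable \<omega> \<eta> \<and> \<psi> / \<omega> = \<zeta> / \<eta> \<and>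
           (\<forall>k. has_order \<rho> \<psi> \<omega> k \<longleftrightarrow> has_order \<rho> \<zeta> \<eta> k)"
proof -
  have \<gamma>: "\<gamma> = \<zeta> - \<eta>" and adm: "admissible_terms \<rho> \<zeta> \<eta>"
    using assms(4) by (simp_all add: is_apotome_def)
  then have pos: "0 < \<eta>" "\<eta> < \<zeta>"
    and rat: "\<zeta>\<^sup>2 / \<rho>\<^sup>2 \<in> \<rat>" "\<eta>\<^sup>2 / \<rho>\<^sup>2 \<in> \<rat>"
    by (simp_all add: admissible_terms_def commensurable_def)
  define c where "c = r\<^sup>2 / (\<zeta>\<^sup>2 - \<eta>\<^sup>2)"
  have diff: "\<zeta>\<^sup>2 - \<eta>\<^sup>2 = (\<zeta> - \<eta>) * (\<zeta> + \<eta>)"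
    by (simp add: power2_eq_square algebra_simps)
  then have c_pos: "0 < c"
    using pos \<open>0 < r\<close> by (simp add: c_def)
  have "c = (r\<^sup>2 / \<rho>\<^sup>2) / (\<zeta>\<^sup>2 / \<rho>\<^sup>2 - \<eta>\<^sup>2 / \<rho>\<^sup>2)"
    using \<open>0 < \<rho>\<close> by (simp add: c_def flip: diff_divide_distrib)
  also have "\<dots> \<in> \<rat>"
    using assms(3) rat
    unfolding rational_line_def commensurable_def by (blast intro: Rats_divide Rats_diff)
  finally have c_rat: "c \<in> \<rat>" .
  have "c * (\<zeta> + \<eta>) = r\<^sup>2 / (\<zeta> - \<eta>)"
    using pos by (simp add: c_def diff)
  also have "\<dots> = \<delta>"
    using pos assms(6) \<gamma> by (simp add: field_simps)
  finally have \<delta>: "\<delta> = c * \<zeta> + c * \<eta>"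
    by (simp add: distrib_left)
  show ?thesis
  proof (intro exI conjI allI)
    show "is_binomial \<rho> \<delta> (c * \<zeta>) (c * \<eta>)"
      using \<delta> adm admissible_terms_scale[OF c_rat c_pos] by (simp add: is_binomial_def)
    show "commensurable (c * \<zeta>) \<zeta>" and "commensurable (c * \<eta>) \<eta>"
      using c_rat pos by (simp_all add: commensurable_def)
    show "c * \<zeta> / (c * \<eta>) = \<zeta> / \<eta>"
      using c_pos by simp
    show "has_order \<rho> (c * \<zeta>) (c * \<eta>) k \<longleftrightarrow> has_order \<rho> \<zeta> \<eta> k" for k
      by (rule has_order_scale[OF c_rat c_pos])
  qed
qed

end
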